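(* Let $R$ be a ring such that $R = U(R)\cup \Delta(R)\cup \mathrm{Id}(R)$. Then exactly one of the following holds: (1) $R$ is a local ring; (2) $R$ is a Boolean ring; (3) $R$ is a non-abelian Dedekind-finite ring with characteristic $2$.
   Context: Rings are associative with identity, not necessarily commutative. $U(R)$ is the group of units of $R$ and $\mathrm{Id}(R)$ is the set of idempotents of $R$. $\Delta(R)=\{r\in R : r+u\in U(R)\text{ for all }u\in U(R)\}$; equivalently $\Delta(R)=J(T)$, where $T$ is the subring of $R$ generated by $U(R)$ and $J$ denotes the Jacobson radical. A ring $R$ is local if $R/J(R)$ is a division ring; Boolean if every element is idempotent; abelian if every idempotent is central; Dedekind-finite if $ab=1$ implies $ba=1$ for all $a,b\in R$.
   Formalization: "Exactly one" fails for the field with two elements, which is both local and Boolean; the formal theorem claims exactly one of (1)–(3) for R not isomorphic to F_2, and for R isomorphic to F_2 that (1) and (2) hold and (3) fails. *)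

theory Defs
  imports "HOL-Algebra.QuotRing" "HOL-Algebra.IntRing"
begin

definition idempotents :: "('a, 'b) ring_scheme \<Rightarrow> 'a set" where
  "idempotents R = {e \<in> carrier R. e \<otimes>\<^bsub>R\<^esub> e = e}"

definition Delta :: "('a, 'b) ring_scheme \<Rightarrow> 'a set" where
  "Delta R = {r \<in> carrier R. \<forall>u \<in> Units R. r \<oplus>\<^bsub>R\<^esub> u \<in> Units R}"

(* The library's ideals are two-sided, so its maximalideal is not the notion
   whose intersection gives the Jacobson radical of a noncommutative ring. *)
definition left_ideal :: "'a set \<Rightarrow> ('a, 'b) ring_scheme \<Rightarrow> bool" where
  "left_ideal I R \<longleftrightarrow>
     additive_subgroup I R \<and> (\<forall>x \<in> carrier R. \<forall>a \<in> I. x \<otimes>\<^bsub>R\<^esub> a \<in> I)"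

definition maximal_left_ideal :: "'a set \<Rightarrow> ('a, 'b) ring_scheme \<Rightarrow> bool" where
  "maximal_left_ideal M R \<longleftrightarrow>
     left_ideal M R \<and> M \<noteq> carrier R \<and>
     (\<forall>I. left_ideal I R \<and> M \<subseteq> I \<longrightarrow> I = M \<or> I = carrier R)"

(* Intersecting with the carrier only matters for the zero ring, which has no
   maximal left ideals and is its own radical. *)
definition jacobson_radical :: "('a, 'b) ring_scheme \<Rightarrow> 'a set" where
  "jacobson_radical R = carrier R \<inter> \<Inter>{M. maximal_left_ideal M R}"

definition division_ring :: "('a, 'b) ring_scheme \<Rightarrow> bool" where
  "division_ring D \<longleftrightarrow>
     ring D \<and> \<one>\<^bsub>D\<^esub> \<noteq> \<zero>\<^bsub>D\<^esub> \<and> Units D = carrier D - {\<zero>\<^bsub>D\<^esub>}"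

definition local_ring :: "('a, 'b) ring_scheme \<Rightarrow> bool" where
  "local_ring R \<longleftrightarrow> ring R \<and> division_ring (R Quot jacobson_radical R)"

definition boolean_ring :: "('a, 'b) ring_scheme \<Rightarrow> bool" where
  "boolean_ring R \<longleftrightarrow> ring R \<and> (\<forall>x \<in> carrier R. x \<in> idempotents R)"

definition abelian_ring :: "('a, 'b) ring_scheme \<Rightarrow> bool" where
  "abelian_ring R \<longleftrightarrow> ring R \<and>
     (\<forall>e \<in> idempotents R. \<forall>x \<in> carrier R. e \<otimes>\<^bsub>R\<^esub> x = x \<otimes>\<^bsub>R\<^esub> e)"

definition dedekind_finite :: "('a, 'b) ring_scheme \<Rightarrow> bool" where
  "dedekind_finite R \<longleftrightarrow> ring R \<and>
     (\<forall>a \<in> carrier R. \<forall>b \<in> carrier R.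
        a \<otimes>\<^bsub>R\<^esub> b = \<one>\<^bsub>R\<^esub> \<longrightarrow> b \<otimes>\<^bsub>R\<^esub> a = \<one>\<^bsub>R\<^esub>)"

definition ring_characteristic :: "('a, 'b) ring_scheme \<Rightarrow> nat" where
  "ring_characteristic R =
     (if \<exists>n::nat. n > 0 \<and> [n] \<cdot>\<^bsub>R\<^esub> \<one>\<^bsub>R\<^esub> = \<zero>\<^bsub>R\<^esub>
      then LEAST n::nat. n > 0 \<and> [n] \<cdot>\<^bsub>R\<^esub> \<one>\<^bsub>R\<^esub> = \<zero>\<^bsub>R\<^esub>
      else 0)"

definition exactly_one_of :: "bool \<Rightarrow> bool \<Rightarrow> bool \<Rightarrow> bool" where
  "exactly_one_of P Q S \<longleftrightarrow>
     (P \<and> \<not> Q \<and> \<not> S) \<or> (\<not> P \<and> Q \<and> \<not> S) \<or> (\<not> P \<and> \<not> Q \<and> S)"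

end

theory Submission
  imports Defs
begin

text \<open>
  The set \<open>\<Delta>(R)\<close> is closed under sums, products and multiplication by units, and \<open>0\<close> is its only
  idempotent. If \<open>0\<close> and \<open>1\<close> are the only idempotents, then \<open>R = U(R) \<union> \<Delta>(R)\<close>, so \<open>\<Delta>(R)\<close> is an
  ideal whose complement consists of units, and \<open>R\<close> is local. Otherwise take an idempotent
  \<open>e \<noteq> 0, 1\<close>. Neither \<open>-e\<close> nor \<open>-(1 - e)\<close> can be a unit or lie in \<open>\<Delta>(R)\<close>, so both are idempotent,
  which gives \<open>2e = 0 = 2(1 - e)\<close> and \<open>2 = 0\<close>. If moreover \<open>e\<close> is central, then for a unit \<open>u\<close> the
  elements \<open>ue\<close> and \<open>u(1 - e)\<close> must be idempotent, whence \<open>u = 1\<close>; as \<open>1 + \<Delta>(R) \<subseteq> U(R)\<close>, only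
  idempotents are left. Dedekind-finiteness holds because \<open>ab = 1\<close> with \<open>a, b \<in> \<Delta>(R)\<close> would put \<open>1\<close>
  in \<open>\<Delta>(R)\<close>. The alternatives are separated by the idempotents: a local ring has only \<open>0\<close> and \<open>1\<close>.
\<close>

subsection \<open>Local rings and their idempotents\<close>

context ring
begin

section \<open>Left ideals and maximal left ideals\<close>

lemma left_ideal_one_imp_carrier:
  assumes "left_ideal L R" "\<one> \<in> L"
  shows "L = carrier R"
proof
  show "L \<subseteq> carrier R"
    using assms(1) additive_subgroup.a_subset[of L R] unfolding left_ideal_def by blast
  show "carrier R \<subseteq> L"
  proof
    fix x assume "x \<in> carrier R"
    then have "x \<otimes> \<one> \<in> L"
      using assms unfolding left_ideal_def by blast
    then show "x \<in> L"
      using \<open>x \<in> carrier R\<close> by simp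
  qed
qed

lemma left_ideal_unit_imp_carrier:
  assumes "left_ideal L R" "u \<in> L" "u \<in> Units R"
  shows "L = carrier R"
proof (rule left_ideal_one_imp_carrier)
  have "inv u \<otimes> u \<in> L"
    using assms unfolding left_ideal_def by blast
  then show "\<one> \<in> L"
    using assms(3) by simp
qed (use assms in simp)

text \<open>Negation is left multiplication by \<open>\<ominus> \<one>\<close>, so closure under
  negatives follows from closure under left multiples.\<close>

lemma left_idealI:
  assumes "I \<subseteq> carrier R" "\<zero> \<in> I"
    and "\<And>x y. x \<in> I \<Longrightarrow> y \<in> I \<Longrightarrow> x \<oplus> y \<in> I"
    and "\<And>r x. r \<in> carrier R \<Longrightarrow> x \<in> I \<Longrightarrow> r \<otimes> x \<in> I"
  shows "left_ideal I R"
proof -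
  have "\<ominus> x \<in> I" if "x \<in> I" for x
    using assms(4)[of "\<ominus> \<one>" x] that assms(1) by (auto simp: l_minus)
  then have "subgroup I (add_monoid R)"
    using assms by (intro add.subgroupI) (auto simp flip: a_inv_def)
  then show ?thesis
    using assms(4) by (auto simp: left_ideal_def intro: additive_subgroup.intro)
qed

lemma left_ideal_closed:
  assumes "left_ideal L R"
  shows "L \<subseteq> carrier R" "\<zero> \<in> L"
    and "\<And>x y. x \<in> L \<Longrightarrow> y \<in> L \<Longrightarrow> x \<oplus> y \<in> L"
    and "\<And>r x. r \<in> carrier R \<Longrightarrow> x \<in> L \<Longrightarrow> r \<otimes> x \<in> L"
proof -
  interpret additive_subgroup L R
    using assms unfolding left_ideal_def by blast
  show "L \<subseteq> carrier R" "\<zero> \<in> L" "\<And>x y. x \<in> L \<Longrightarrow> y \<in> L \<Longrightarrow> x \<oplus> y \<in> L"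
    by (simp_all add: a_subset)
  show "r \<otimes> x \<in> L" if "r \<in> carrier R" "x \<in> L" for r x
    using assms that unfolding left_ideal_def by blast
qed

text \<open>An intersection of left ideals inherits their closure properties. This is what allows
  cosets of the radical to be handled as cosets of an additive subgroup.\<close>

lemma additive_subgroup_jacobson_radical: "additive_subgroup (jacobson_radical R) R"
proof -
  have *: "left_ideal M R" if "maximal_left_ideal M R" for M
    using that unfolding maximal_left_ideal_def by blast
  have "left_ideal (jacobson_radical R) R"
  proof (rule left_idealI)
    show "\<zero> \<in> jacobson_radical R"
      unfolding jacobson_radical_def using left_ideal_closed(2)[OF *] by blast
    show "x \<oplus> y \<in> jacobson_radical R"
      if "x \<in> jacobson_radical R" "y \<in> jacobson_radical R" for x y
      using that left_ideal_closed(3)[OF *] unfolding jacobson_radical_def by blast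
    show "r \<otimes> x \<in> jacobson_radical R"
      if "r \<in> carrier R" "x \<in> jacobson_radical R" for r x
      using that left_ideal_closed(4)[OF *] unfolding jacobson_radical_def by blast
  qed (simp add: jacobson_radical_def)
  then show ?thesis
    by (simp add: left_ideal_def)
qed

text \<open>Zorn's lemma applies to the left ideals that contain \<open>L\<close> and miss
  \<open>\<one>\<close>: a union of a chain still misses \<open>\<one>\<close>. A maximal member is
  maximal among all proper left ideals, since a left ideal containing \<open>\<one>\<close> is the
  whole ring.\<close>

lemma maximal_left_ideal_exists:
  assumes "left_ideal L R" "\<one> \<notin> L"
  obtains M where "maximal_left_ideal M R" "L \<subseteq> M"
proof -
  let ?A = "{I. left_ideal I R \<and> \<one> \<notin> I \<and> L \<subseteq> I}"
  have "\<exists>M\<in>?A. \<forall>X\<in>?A. M \<subseteq> X \<longrightarrow> X = M"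
  proof (rule subset_Zorn_nonempty)
    show "?A \<noteq> {}"
      using assms by blast
  next
    fix C assume "C \<noteq> {}" and C: "subset.chain ?A C"
    then have sub: "C \<subseteq> ?A" and lin: "\<And>X Y. X \<in> C \<Longrightarrow> Y \<in> C \<Longrightarrow> X \<subseteq> Y \<or> Y \<subseteq> X"
      by (auto simp: subset_chain_def)
    have ideals: "left_ideal X R" if "X \<in> C" for X
      using that sub by blast
    have "left_ideal (\<Union>C) R"
    proof (rule left_idealI)
      show "\<Union>C \<subseteq> carrier R"
        using left_ideal_closed(1)[OF ideals] by blast
      show "\<zero> \<in> \<Union>C"
        using \<open>C \<noteq> {}\<close> left_ideal_closed(2)[OF ideals] by blast
      show "r \<otimes> x \<in> \<Union>C" if "r \<in> carrier R" "x \<in> \<Union>C" for r x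
        using that left_ideal_closed(4)[OF ideals] by blast
    next
      fix x y assume "x \<in> \<Union>C" "y \<in> \<Union>C"
      then obtain X Y where "X \<in> C" "Y \<in> C" "x \<in> X" "y \<in> Y"
        by blast
      then obtain Z where "Z \<in> C" "x \<in> Z" "y \<in> Z"
        using lin by blast
      then show "x \<oplus> y \<in> \<Union>C"
        using left_ideal_closed(3)[OF ideals] by blast
    qed
    moreover have "\<one> \<notin> \<Union>C"
      using sub by blast
    moreover have "L \<subseteq> \<Union>C"
      using sub \<open>C \<noteq> {}\<close> by blast
    ultimately show "\<Union>C \<in> ?A"
      by simp
  qed
  then obtain M where M: "M \<in> ?A" and max: "\<forall>X\<in>?A. M \<subseteq> X \<longrightarrow> X = M" ..
  have "maximal_left_ideal M R"
    unfolding maximal_left_ideal_def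
  proof (intro conjI allI impI)
    show "left_ideal M R"
      using M by blast
    show "M \<noteq> carrier R"
      using M one_closed by blast
    fix I assume I: "left_ideal I R \<and> M \<subseteq> I"
    show "I = M \<or> I = carrier R"
    proof (cases "\<one> \<in> I")
      case True
      then show ?thesis
        using I left_ideal_one_imp_carrier by blast
    next
      case False
      then show ?thesis
        using I M max by blast
    qed
  qed
  then show ?thesis
    using M that by blast
qed

section \<open>Idempotents and their complements\<close>

lemma idempotent_compl:
  assumes "e \<in> idempotents R"
  shows "\<one> \<ominus> e \<in> idempotents R"
proof -
  from assms have e: "e \<in> carrier R" "e \<otimes> e = e"
    by (auto simp: idempotents_def)
  then have "(\<one> \<ominus> e) \<otimes> e = \<zero>"
    by (simp add: minus_eq l_distr l_minus r_neg)
  then have "(\<one> \<ominus> e) \<otimes> (\<one> \<ominus> e) = \<one> \<ominus> e"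
    using e by (simp add: minus_eq r_distr r_minus)
  then show ?thesis
    using e by (simp add: idempotents_def)
qed

lemma idempotent_mult_compl:
  assumes "e \<in> idempotents R"
  shows "(\<one> \<ominus> e) \<otimes> e = \<zero>"
  using assms by (simp add: idempotents_def minus_eq l_distr l_minus r_neg)

lemma compl_compl: "x \<in> carrier R \<Longrightarrow> \<one> \<ominus> (\<one> \<ominus> x) = x"
  by algebra

lemma compl_eq_zero_iff:
  assumes "x \<in> carrier R"
  shows "\<one> \<ominus> x = \<zero> \<longleftrightarrow> x = \<one>"
proof
  assume "\<one> \<ominus> x = \<zero>"
  then have "\<one> \<ominus> (\<one> \<ominus> x) = \<one> \<ominus> \<zero>"
    by simp
  then show "x = \<one>"
    using compl_compl[OF assms] by (simp add: minus_eq)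
qed (use assms in \<open>simp add: minus_eq r_neg\<close>)

lemma idempotent_unit_eq_one:
  assumes "e \<in> idempotents R" "e \<in> Units R"
  shows "e = \<one>"
  using assms Units_l_cancel[of e e \<one>] by (auto simp: idempotents_def)

text \<open>For nonzero \<open>e\<close> the left ideal generated by \<open>1 - e\<close> is proper,
  because right multiplication by \<open>e\<close> annihilates it but sends \<open>1\<close> to
  \<open>e\<close>. A maximal left ideal above it contains \<open>1 - e\<close>, and also
  \<open>e\<close> as an element of the radical, hence their sum \<open>1\<close>.\<close>

lemma idempotent_in_jacobson_radical:
  assumes "e \<in> idempotents R" "e \<in> jacobson_radical R"
  shows "e = \<zero>"
proof (rule ccontr)
  assume "e \<noteq> \<zero>"
  have e: "e \<in> carrier R"
    using assms by (auto simp: idempotents_def)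
  let ?L = "(\<lambda>s. s \<otimes> (\<one> \<ominus> e)) ` carrier R"
  have mem: "s \<otimes> (\<one> \<ominus> e) \<in> ?L" if "s \<in> carrier R" for s
    using that by blast
  have "left_ideal ?L R"
  proof (rule left_idealI)
    show "\<zero> \<in> ?L"
      using mem[of \<zero>] e by simp
    show "x \<oplus> y \<in> ?L" if "x \<in> ?L" "y \<in> ?L" for x y
      using that e by (auto simp: l_distr[symmetric])
    show "r \<otimes> x \<in> ?L" if "r \<in> carrier R" "x \<in> ?L" for r x
      using that e by (auto simp: m_assoc[symmetric])
  qed (use e in auto)
  moreover have "\<one> \<notin> ?L"
  proof
    assume "\<one> \<in> ?L"
    then obtain s where s: "s \<in> carrier R" "\<one> = s \<otimes> (\<one> \<ominus> e)"
      by blast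
    have "e = s \<otimes> (\<one> \<ominus> e) \<otimes> e"
      using s(2) e by simp
    also have "\<dots> = s \<otimes> ((\<one> \<ominus> e) \<otimes> e)"
      using s(1) e by (simp add: m_assoc)
    also have "\<dots> = \<zero>"
      using s(1) by (simp add: idempotent_mult_compl[OF assms(1)])
    finally show False
      using \<open>e \<noteq> \<zero>\<close> by simp
  qed
  ultimately obtain M where M: "maximal_left_ideal M R" "?L \<subseteq> M"
    by (rule maximal_left_ideal_exists)
  then have "left_ideal M R" "M \<noteq> carrier R"
    unfolding maximal_left_ideal_def by blast+
  moreover have "e \<in> M"
    using assms(2) M(1) by (auto simp: jacobson_radical_def)
  moreover have "\<one> \<ominus> e \<in> M"
    using mem[of \<one>] e M(2) by auto
  ultimately have "e \<oplus> (\<one> \<ominus> e) \<in> M"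
    using left_ideal_closed(3) by blast
  moreover have "e \<oplus> (\<one> \<ominus> e) = \<one>"
    using e by algebra
  ultimately have "\<one> \<in> M"
    by (rule back_subst[where P = "\<lambda>x. x \<in> M"])
  then show False
    using \<open>left_ideal M R\<close> \<open>M \<noteq> carrier R\<close> left_ideal_one_imp_carrier by blast
qed

text \<open>If \<open>1 = 0\<close>, the one and the zero of the quotient are the same coset, which
  a division ring forbids. This excludes the zero ring, which is Boolean, from the local
  rings.\<close>

lemma local_ring_one_not_zero:
  assumes "local_ring R"
  shows "\<one> \<noteq> \<zero>"
proof
  assume "\<one> = \<zero>"
  then have "jacobson_radical R +> \<one> = jacobson_radical R"
    using a_coset_add_zero[OF additive_subgroup.a_subset[OF additive_subgroup_jacobson_radical]]
    by metis
  then show False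
    using assms unfolding local_ring_def division_ring_def FactRing_def monoid.simps ring.simps by blast
qed

text \<open>The coset of \<open>e\<close> is an idempotent of a division ring, hence its zero or its
  one. Accordingly \<open>e\<close> or \<open>1 - e\<close> lies in the radical, where the only
  idempotent is \<open>0\<close>.\<close>

lemma local_ring_idempotents:
  assumes "local_ring R" "e \<in> idempotents R"
  shows "e = \<zero> \<or> e = \<one>"
proof -
  define J where "J = jacobson_radical R"
  interpret J: abelian_subgroup J R
    unfolding J_def
    by (intro abelian_subgroupI3 additive_subgroup_jacobson_radical is_abelian_group)
  define Q where "Q = R Quot J"
  have Q: "ring Q" "Units Q = carrier Q - {\<zero>\<^bsub>Q\<^esub>}"
    using assms(1) unfolding Q_def J_def local_ring_def division_ring_def by blast+
  interpret Q: ring Q by fact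
  have e: "e \<in> carrier R" "e \<otimes> e = e"
    using assms(2) by (auto simp: idempotents_def)
  define E where "E = J +> e"
  have E: "E \<in> carrier Q"
    using e a_rcosetsI[OF J.a_subset] by (simp add: E_def Q_def FactRing_def)
  have "e \<in> E"
    using e J.a_rcos_self by (simp add: E_def)
  \<comment> \<open>The product of two cosets is only known to be some coset, because the radical is not
    shown to be a right ideal; here the coset is identified by an element it contains.\<close>
  have "E \<otimes>\<^bsub>Q\<^esub> E \<in> carrier Q"
    using E by simp
  then obtain c where c: "c \<in> carrier R" "E \<otimes>\<^bsub>Q\<^esub> E = J +> c"
    by (auto simp: Q_def FactRing_def A_RCOSETS_def')
  have "e \<in> J +> (e \<otimes> e)"
    using e J.a_rcos_self by simp
  moreover have "E \<otimes>\<^bsub>Q\<^esub> E = (\<Union>a\<in>E. \<Union>b\<in>E. J +> (a \<otimes> b))"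
    by (simp add: Q_def FactRing_def rcoset_mult_def)
  ultimately have "e \<in> E \<otimes>\<^bsub>Q\<^esub> E"
    using \<open>e \<in> E\<close> by blast
  then have "e \<in> J +> c"
    using c(2) by simp
  then have "J +> c = J +> e"
    by (rule a_repr_independence[OF _ c(1) J.a_subgroup])
  then have EE: "E \<otimes>\<^bsub>Q\<^esub> E = E"
    using c(2) by (simp add: E_def)
  have "E = \<zero>\<^bsub>Q\<^esub> \<or> E = \<one>\<^bsub>Q\<^esub>"
  proof (rule disjCI)
    assume "E \<noteq> \<one>\<^bsub>Q\<^esub>"
    \<comment> \<open>If \<open>E\<close> were a unit, cancelling it in \<open>E E = E 1\<close>
      would give \<open>E = 1\<close>.\<close>
    then have "E \<notin> Units Q"
      using Q.Units_l_cancel[OF _ E Q.one_closed] EE E Q.r_one by metis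
    then show "E = \<zero>\<^bsub>Q\<^esub>"
      using E Q(2) by blast
  qed
  then show ?thesis
  proof
    assume "E = \<zero>\<^bsub>Q\<^esub>"
    then have "e \<in> J"
      using \<open>e \<in> E\<close> by (simp add: Q_def FactRing_def)
    then show ?thesis
      using idempotent_in_jacobson_radical assms(2) by (simp add: J_def)
  next
    assume "E = \<one>\<^bsub>Q\<^esub>"
    then have "e \<in> J +> \<one>"
      using \<open>e \<in> E\<close> by (simp add: Q_def FactRing_def)
    then obtain j where j: "j \<in> J" "e = j \<oplus> \<one>"
      by (auto simp: a_r_coset_def')
    then have "\<one> \<ominus> e = \<ominus> j"
      using J.a_Hcarr[OF j(1)] by algebra
    then have "\<one> \<ominus> e \<in> J"
      using j by simp
    then have "\<one> \<ominus> e = \<zero>"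
      using idempotent_in_jacobson_radical[OF idempotent_compl[OF assms(2)]] by (simp add: J_def)
    then show ?thesis
      using e compl_eq_zero_iff by blast
  qed
qed

text \<open>A proper left ideal contains no unit and therefore lies in \<open>I\<close>; so
  \<open>I\<close> is the only maximal left ideal and equals the radical. Because \<open>I\<close>
  is two-sided, cosets multiply through representatives, and a nonzero coset is represented by a
  unit, whose inverse represents the inverse coset.\<close>

lemma local_ringI:
  assumes "ideal I R" "\<one> \<notin> I" "carrier R = Units R \<union> I"
  shows "local_ring R"
proof -
  interpret I: ideal I R by fact
  have I: "left_ideal I R"
    by (simp add: left_ideal_def I.additive_subgroup_axioms I.I_l_closed)
  have sub: "L \<subseteq> I" if "left_ideal L R" "L \<noteq> carrier R" for L
  proof -
    have "L \<subseteq> carrier R"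
      by (rule left_ideal_closed(1)[OF that(1)])
    then show ?thesis
      using that left_ideal_unit_imp_carrier assms(3) by blast
  qed
  have "I \<noteq> carrier R"
    using assms(2) by blast
  then have "maximal_left_ideal I R"
    using I sub unfolding maximal_left_ideal_def by blast
  moreover have "M = I" if "maximal_left_ideal M R" for M
    using that I sub[of M] \<open>I \<noteq> carrier R\<close> unfolding maximal_left_ideal_def by blast
  ultimately have "{M. maximal_left_ideal M R} = {I}"
    by blast
  then have J: "jacobson_radical R = I"
    using I.a_subset by (simp add: jacobson_radical_def Int_absorb1)
  interpret Q: ring "R Quot I"
    by (rule I.quotient_is_ring)
  have ne: "I +> u \<noteq> I" if "u \<in> Units R" for u
  proof
    assume "I +> u = I"
    then have "u \<in> I"
      using I.a_rcos_self[OF Units_closed[OF that]] by simp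
    then show False
      using that I left_ideal_unit_imp_carrier \<open>I \<noteq> carrier R\<close> by blast
  qed
  then have one: "\<one>\<^bsub>R Quot I\<^esub> \<noteq> \<zero>\<^bsub>R Quot I\<^esub>"
    by (simp add: FactRing_def)
  have "Units (R Quot I) = carrier (R Quot I) - {\<zero>\<^bsub>R Quot I\<^esub>}"
  proof
    have "\<zero>\<^bsub>R Quot I\<^esub> \<notin> Units (R Quot I)"
      using one Q.Units_r_inv[of "\<zero>\<^bsub>R Quot I\<^esub>"] Q.l_null[OF Q.Units_inv_closed] by metis
    then show "Units (R Quot I) \<subseteq> carrier (R Quot I) - {\<zero>\<^bsub>R Quot I\<^esub>}"
      by blast
    show "carrier (R Quot I) - {\<zero>\<^bsub>R Quot I\<^esub>} \<subseteq> Units (R Quot I)"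
    proof
      fix X assume X: "X \<in> carrier (R Quot I) - {\<zero>\<^bsub>R Quot I\<^esub>}"
      then obtain x where x: "x \<in> carrier R" "X = I +> x" "X \<noteq> I"
        by (auto simp: FactRing_def A_RCOSETS_def')
      then have u: "x \<in> Units R"
        using assms(3) I.a_rcos_const[of x] by blast
      have mult: "(I +> y) \<otimes>\<^bsub>R Quot I\<^esub> (I +> z) = I +> (y \<otimes> z)"
        if "y \<in> carrier R" "z \<in> carrier R" for y z
        using that I.rcoset_mult_add by (simp add: FactRing_def)
      have "I +> inv x \<in> carrier (R Quot I)"
        using u a_rcosetsI[OF I.a_subset] by (simp add: FactRing_def)
      moreover have "(I +> inv x) \<otimes>\<^bsub>R Quot I\<^esub> X = \<one>\<^bsub>R Quot I\<^esub>"
        "X \<otimes>\<^bsub>R Quot I\<^esub> (I +> inv x) = \<one>\<^bsub>R Quot I\<^esub>"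
        using u x(1) by (simp_all add: x(2) mult) (simp_all add: FactRing_def)
      ultimately show "X \<in> Units (R Quot I)"
        using X unfolding Units_def by blast
    qed
  qed
  then show ?thesis
    by (simp add: local_ring_def division_ring_def J one Q.ring_axioms ring_axioms)
qed

subsection \<open>The set \<open>\<Delta>(R)\<close>\<close>

lemma Delta_closed: "r \<in> Delta R \<Longrightarrow> r \<in> carrier R"
  by (simp add: Delta_def)

lemma Delta_add_unit: "r \<in> Delta R \<Longrightarrow> u \<in> Units R \<Longrightarrow> r \<oplus> u \<in> Units R"
  by (simp add: Delta_def)

lemma zero_in_Delta: "\<zero> \<in> Delta R"
  by (simp add: Delta_def Units_closed)

lemma Delta_add:
  assumes "r \<in> Delta R" "s \<in> Delta R"
  shows "r \<oplus> s \<in> Delta R"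
  unfolding Delta_def
proof (intro CollectI conjI ballI)
  note [simp] = assms[THEN Delta_closed]
  show "r \<oplus> s \<in> carrier R"
    by simp
  fix u assume u: "u \<in> Units R"
  then have "r \<oplus> (s \<oplus> u) \<in> Units R"
    using assms Delta_add_unit by blast
  then show "r \<oplus> s \<oplus> u \<in> Units R"
    using u by (simp add: a_assoc Units_closed)
qed

text \<open>Factoring out the unit, \<open>u r + v = u (r + inv u v)\<close> is a product of two
  units.\<close>

lemma Delta_unit_mult:
  assumes "u \<in> Units R" "r \<in> Delta R"
  shows "u \<otimes> r \<in> Delta R"
  unfolding Delta_def
proof (intro CollectI conjI ballI)
  note [simp] = assms(1)[THEN Units_closed] assms(2)[THEN Delta_closed]
  show "u \<otimes> r \<in> carrier R"
    by simp
  fix v assume v: "v \<in> Units R"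
  have "u \<otimes> (r \<oplus> inv u \<otimes> v) = u \<otimes> r \<oplus> (u \<otimes> inv u) \<otimes> v"
    using assms(1) v by (simp add: r_distr m_assoc Units_closed del: Units_r_inv)
  also have "\<dots> = u \<otimes> r \<oplus> v"
    using assms(1) v by (simp add: Units_closed)
  finally show "u \<otimes> r \<oplus> v \<in> Units R"
    using assms v Delta_add_unit by (metis Units_inv_Units Units_m_closed)
qed

text \<open>The mirror image: \<open>r u + v = (r + v inv u) u\<close>.\<close>

lemma Delta_mult_unit:
  assumes "r \<in> Delta R" "u \<in> Units R"
  shows "r \<otimes> u \<in> Delta R"
  unfolding Delta_def
proof (intro CollectI conjI ballI)
  note [simp] = assms(2)[THEN Units_closed] assms(1)[THEN Delta_closed]
  show "r \<otimes> u \<in> carrier R"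
    by simp
  fix v assume v: "v \<in> Units R"
  have "(r \<oplus> v \<otimes> inv u) \<otimes> u = r \<otimes> u \<oplus> v \<otimes> (inv u \<otimes> u)"
    using assms(2) v by (simp add: l_distr m_assoc Units_closed del: Units_l_inv)
  also have "\<dots> = r \<otimes> u \<oplus> v"
    using assms(2) v by (simp add: Units_closed)
  finally show "r \<otimes> u \<oplus> v \<in> Units R"
    using assms v Delta_add_unit by (metis Units_inv_Units Units_m_closed)
qed

lemma Delta_neg:
  assumes "r \<in> Delta R"
  shows "\<ominus> r \<in> Delta R"
  using Delta_unit_mult[OF Units_minus_one_closed assms] Delta_closed[OF assms]
  by (simp add: l_minus)

text \<open>Write \<open>r s = r (s + 1) - r\<close>. Since \<open>s + 1\<close> is a unit, closure
  under unit multiples, negatives and sums suffices.\<close>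

lemma Delta_mult:
  assumes "r \<in> Delta R" "s \<in> Delta R"
  shows "r \<otimes> s \<in> Delta R"
proof -
  note [simp] = assms[THEN Delta_closed]
  have "r \<otimes> (s \<oplus> \<one>) \<oplus> \<ominus> r \<in> Delta R"
    using assms by (intro Delta_add Delta_mult_unit Delta_neg Delta_add_unit) simp_all
  moreover have "r \<otimes> (s \<oplus> \<one>) \<oplus> \<ominus> r = r \<otimes> s"
    by (simp add: r_distr a_assoc r_neg)
  ultimately show ?thesis
    by simp
qed

text \<open>Since \<open>- e\<close> also lies in \<open>Delta R\<close>, the idempotent
  \<open>1 - e\<close> is a unit, and an idempotent unit equals \<open>1\<close>.\<close>

lemma idempotent_in_Delta:
  assumes "e \<in> idempotents R" "e \<in> Delta R"
  shows "e = \<zero>"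
proof -
  have e: "e \<in> carrier R"
    using assms(2) by (rule Delta_closed)
  have "\<ominus> e \<oplus> \<one> \<in> Units R"
    using assms(2) by (intro Delta_add_unit Delta_neg) simp_all
  then have "\<one> \<ominus> e \<in> Units R"
    using e by (simp add: minus_eq a_comm)
  then have "\<one> \<ominus> e = \<one>"
    using assms(1) by (intro idempotent_unit_eq_one idempotent_compl)
  then show ?thesis
    using compl_compl[OF e] by (simp add: minus_eq r_neg)
qed

lemma one_in_Delta: "\<one> \<in> Delta R \<Longrightarrow> \<one> = \<zero>"
  by (rule idempotent_in_Delta) (simp_all add: idempotents_def)

text \<open>Under this covering every multiplier is a unit or an element of \<open>Delta R\<close>,
  and \<open>Delta R\<close> absorbs both kinds on either side.\<close>

lemma Delta_ideal:
  assumes "carrier R = Units R \<union> Delta R"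
  shows "ideal (Delta R) R"
proof -
  have closed: "x \<otimes> r \<in> Delta R" "r \<otimes> x \<in> Delta R"
    if "r \<in> Delta R" "x \<in> carrier R" for r x
    using that assms Delta_mult Delta_mult_unit Delta_unit_mult by blast+
  have "left_ideal (Delta R) R"
    using Delta_closed by (intro left_idealI zero_in_Delta Delta_add closed) blast+
  then have "additive_subgroup (Delta R) R"
    by (simp add: left_ideal_def)
  then show ?thesis
    using closed by (intro ideal.intro ideal_axioms.intro ring_axioms)
qed

subsection \<open>Rings covered by \<open>U(R)\<close>, \<open>\<Delta>(R)\<close> and \<open>Id(R)\<close>\<close>

text \<open>The idempotents \<open>0\<close> and \<open>1\<close> already lie in
  \<open>Delta R\<close> and \<open>Units R\<close>, so these two sets cover the ring and
  \<open>Delta R\<close> serves as the ideal in \<open>local_ringI\<close>.\<close>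

lemma local_ring_of_trivial_idempotents:
  assumes "carrier R = Units R \<union> Delta R \<union> idempotents R" "\<one> \<noteq> \<zero>"
    and "idempotents R \<subseteq> {\<zero>, \<one>}"
  shows "local_ring R"
proof (rule local_ringI)
  show *: "carrier R = Units R \<union> Delta R"
    using assms(1,3) zero_in_Delta Units_one_closed by blast
  then show "ideal (Delta R) R"
    by (rule Delta_ideal)
  show "\<one> \<notin> Delta R"
    using assms(2) one_in_Delta by blast
qed

text \<open>For \<open>e\<close> other than \<open>0\<close> and \<open>1\<close>, were
  \<open>- e\<close> a unit or in \<open>Delta R\<close>, the same would hold for \<open>e\<close>,
  forcing \<open>e = 1\<close> or \<open>e = 0\<close>. So \<open>- e\<close> is idempotent, and its
  square is \<open>e\<close>, whence \<open>- e = e\<close>.\<close>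

lemma double_idempotent_eq_zero:
  assumes "carrier R = Units R \<union> Delta R \<union> idempotents R"
    and "e \<in> idempotents R" "e \<noteq> \<one>"
  shows "e \<oplus> e = \<zero>"
proof (cases "e = \<zero>")
  case False
  have e: "e \<in> carrier R" "e \<otimes> e = e"
    using assms(2) by (simp_all add: idempotents_def)
  have "\<ominus> e \<notin> Units R"
  proof
    assume "\<ominus> e \<in> Units R"
    then have "\<ominus> \<one> \<otimes> \<ominus> e \<in> Units R"
      by (intro Units_m_closed Units_minus_one_closed)
    then have "e \<in> Units R"
      using e by (simp add: l_minus)
    then show False
      using idempotent_unit_eq_one assms(2,3) by blast
  qed
  moreover have "\<ominus> e \<notin> Delta R"
    using Delta_neg[of "\<ominus> e"] idempotent_in_Delta[OF assms(2)] e False by auto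
  moreover have "\<ominus> e \<in> carrier R"
    using e by simp
  ultimately have "\<ominus> e \<in> idempotents R"
    using assms(1) by blast
  then have "e = \<ominus> e"
    using e by (simp add: idempotents_def l_minus r_minus)
  then show ?thesis
    using r_neg[OF e(1)] by simp
qed simp

text \<open>Split \<open>1\<close> as \<open>e + (1 - e)\<close> and double both idempotents;
  \<open>e \<noteq> \<zero>\<close> is what keeps \<open>1 - e\<close> different from
  \<open>1\<close>.\<close>

lemma one_plus_one_eq_zero:
  assumes "carrier R = Units R \<union> Delta R \<union> idempotents R"
    and "e \<in> idempotents R" "e \<noteq> \<zero>" "e \<noteq> \<one>"
  shows "\<one> \<oplus> \<one> = \<zero>"
proof -
  have e: "e \<in> carrier R"
    using assms(2) by (simp add: idempotents_def)
  have "\<one> \<ominus> e \<noteq> \<one>"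
    using compl_compl[OF e] compl_eq_zero_iff[OF one_closed] assms(3) by metis
  then have "(\<one> \<ominus> e) \<oplus> (\<one> \<ominus> e) = \<zero>"
    by (rule double_idempotent_eq_zero[OF assms(1) idempotent_compl[OF assms(2)]])
  moreover have "e \<oplus> e = \<zero>"
    using double_idempotent_eq_zero assms by blast
  moreover have "\<one> \<oplus> \<one> = ((\<one> \<ominus> e) \<oplus> (\<one> \<ominus> e)) \<oplus> (e \<oplus> e)"
    using e by algebra
  ultimately show ?thesis
    by simp
qed

lemma ring_characteristic_eq_two:
  assumes "\<one> \<oplus> \<one> = \<zero>" "\<one> \<noteq> \<zero>"
  shows "ring_characteristic R = 2"
proof -
  have two: "[(2::nat)] \<cdot> \<one> = \<zero>"
    using assms(1) by (simp add: numeral_2_eq_2 add.nat_pow_Suc)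
  have "(LEAST n::nat. n > 0 \<and> [n] \<cdot> \<one> = \<zero>) = 2"
  proof (rule Least_equality)
    show "(2::nat) > 0 \<and> [(2::nat)] \<cdot> \<one> = \<zero>"
      using two by simp
    fix n :: nat assume n: "n > 0 \<and> [n] \<cdot> \<one> = \<zero>"
    have "n \<noteq> 1"
      using n assms(2) by auto
    then show "2 \<le> n"
      using n by linarith
  qed
  moreover have "\<exists>n::nat. n > 0 \<and> [n] \<cdot> \<one> = \<zero>"
    using two by (intro exI[of _ 2]) simp
  ultimately show ?thesis
    unfolding ring_characteristic_def by presburger
qed

text \<open>If \<open>a\<close> or \<open>b\<close> is a unit, the other factor is its inverse; if
  one of them is idempotent, it equals \<open>1\<close>. Only the case with both in
  \<open>Delta R\<close> remains.\<close>

lemma dedekind_finite_of_cover: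
  assumes "carrier R = Units R \<union> Delta R \<union> idempotents R"
  shows "dedekind_finite R"
  unfolding dedekind_finite_def
proof (intro conjI ballI impI)
  fix a b assume a: "a \<in> carrier R" and b: "b \<in> carrier R" and ab: "a \<otimes> b = \<one>"
  consider "a \<in> Units R" | "b \<in> Units R" | "a \<in> idempotents R" | "b \<in> idempotents R"
    | "a \<in> Delta R" "b \<in> Delta R"
    using a b assms by blast
  then show "b \<otimes> a = \<one>"
  proof cases
    case 1
    then have "a \<otimes> b = a \<otimes> inv a"
      using ab by simp
    then have "b = inv a"
      using Units_l_cancel[OF 1 b Units_inv_closed[OF 1]] by blast
    then show ?thesis
      using 1 by simp
  next
    case 2
    have "a = a \<otimes> (b \<otimes> inv b)"
      using 2 a by simp
    also have "\<dots> = (a \<otimes> b) \<otimes> inv b"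
      using 2 a b by (simp add: m_assoc del: Units_r_inv)
    also have "\<dots> = inv b"
      using 2 ab by simp
    finally show ?thesis
      using 2 by simp
  next
    case 3
    \<comment> \<open>As \<open>a b = 1\<close>, the left side is \<open>a\<close> and the right
      side is \<open>1\<close>.\<close>
    then have "a \<otimes> (a \<otimes> b) = a \<otimes> b"
      using a b by (simp add: idempotents_def flip: m_assoc)
    then have "a = \<one>"
      using ab a by simp
    then show ?thesis
      using ab b by simp
  next
    case 4
    then have "(a \<otimes> b) \<otimes> b = a \<otimes> b"
      using a b by (simp add: idempotents_def m_assoc)
    then have "b = \<one>"
      using ab b by simp
    then show ?thesis
      using ab a by simp
  next
    case 5
    then have "\<one> \<in> Delta R"
      \<comment> \<open>Closure under products puts \<open>a b = 1\<close> into
        \<open>Delta R\<close>, so the ring is zero and all its elements agree.\<close>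
      using Delta_mult ab by metis
    then have "\<one> = \<zero>"
      by (rule one_in_Delta)
    then have "x = \<zero>" if "x \<in> carrier R" for x
      using r_one[OF that] r_null[OF that] by simp
    then show ?thesis
      using a b by (metis m_closed one_closed)
  qed
qed (rule ring_axioms)

text \<open>For nonzero \<open>e\<close>, multiplying by \<open>inv u\<close> turns
  \<open>u e\<close> back into \<open>e\<close>, so \<open>u e\<close> is neither a unit nor in
  \<open>Delta R\<close> and must be idempotent. Commuting \<open>e\<close> past \<open>u\<close>
  then gives \<open>u u e = u e\<close>, and \<open>u\<close> cancels.\<close>

lemma central_idempotent_mult_unit:
  assumes "carrier R = Units R \<union> Delta R \<union> idempotents R"
    and e: "e \<in> idempotents R" "e \<noteq> \<one>"
    and u: "u \<in> Units R" and comm: "e \<otimes> u = u \<otimes> e"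
  shows "u \<otimes> e = e"
proof (cases "e = \<zero>")
  case False
  have [simp]: "e \<in> carrier R" "u \<in> carrier R" and ee: "e \<otimes> e = e"
    using e u by (auto simp: idempotents_def)
  have inv: "inv u \<otimes> (u \<otimes> e) = e"
    using u by (simp flip: m_assoc)
  have "u \<otimes> e \<notin> Units R"
  proof
    assume "u \<otimes> e \<in> Units R"
    then have "inv u \<otimes> (u \<otimes> e) \<in> Units R"
      by (rule Units_m_closed[OF Units_inv_Units[OF u]])
    then show False
      using inv e idempotent_unit_eq_one by simp
  qed
  moreover have "u \<otimes> e \<notin> Delta R"
    using Delta_unit_mult[OF Units_inv_Units[OF u], of "u \<otimes> e"] inv
      idempotent_in_Delta[OF e(1)] False by auto
  moreover have "u \<otimes> e \<in> carrier R"
    by simp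
  ultimately have "u \<otimes> e \<in> idempotents R"
    using assms(1) by blast
  then have "(u \<otimes> e) \<otimes> (u \<otimes> e) = u \<otimes> e"
    by (simp add: idempotents_def)
  moreover have "(u \<otimes> e) \<otimes> (u \<otimes> e) = u \<otimes> (u \<otimes> e)"
  proof -
    have "(u \<otimes> e) \<otimes> (u \<otimes> e) = u \<otimes> ((e \<otimes> u) \<otimes> e)"
      by (simp add: m_assoc)
    also have "\<dots> = u \<otimes> (u \<otimes> e)"
      unfolding comm by (simp add: m_assoc ee)
    finally show ?thesis .
  qed
  ultimately have "u \<otimes> (u \<otimes> e) = u \<otimes> e"
    by simp
  then show ?thesis
    using u by simp
qed (use u in auto)

text \<open>Squaring \<open>- x\<close> gives \<open>- x = x\<close>, and squaring
  \<open>x + y\<close> gives \<open>x y + y x = 0\<close>; together they yield commutativity. This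
  separates the Boolean alternative from the non-abelian one.\<close>

lemma boolean_ring_imp_abelian:
  assumes "boolean_ring R"
  shows "abelian_ring R"
proof -
  have sq: "x \<otimes> x = x" if "x \<in> carrier R" for x
    using that assms by (simp add: boolean_ring_def idempotents_def)
  have neg: "\<ominus> x = x" if "x \<in> carrier R" for x
    using that sq[of x] sq[of "\<ominus> x"] by (simp add: l_minus r_minus)
  have "x \<otimes> y = y \<otimes> x" if [simp]: "x \<in> carrier R" "y \<in> carrier R" for x y
  proof -
    have "x \<oplus> y = (x \<oplus> y) \<otimes> (x \<oplus> y)"
      by (simp add: sq)
    also have "\<dots> = (x \<otimes> x \<oplus> y \<otimes> y) \<oplus> (x \<otimes> y \<oplus> y \<otimes> x)"
      using that by algebra
    also have "\<dots> = (x \<oplus> y) \<oplus> (x \<otimes> y \<oplus> y \<otimes> x)"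
      by (simp add: sq)
    finally have "x \<otimes> y \<oplus> y \<otimes> x = \<zero>"
      by simp
    then have "\<ominus> (y \<otimes> x) = x \<otimes> y"
      by (intro minus_equality) simp_all
    then show ?thesis
      by (simp add: neg)
  qed
  then show ?thesis
    by (auto simp: abelian_ring_def idempotents_def ring_axioms)
qed

text \<open>A unit fixes both \<open>e\<close> and \<open>1 - e\<close> under left multiplication,
  hence fixes their sum, so \<open>1\<close> is the only unit. An element \<open>x\<close> of
  \<open>Delta R\<close> then satisfies \<open>x + 1 = 1\<close>.\<close>

lemma boolean_ring_of_abelian:
  assumes cover: "carrier R = Units R \<union> Delta R \<union> idempotents R"
    and "abelian_ring R"
    and e: "e \<in> idempotents R" "e \<noteq> \<zero>" "e \<noteq> \<one>"
  shows "boolean_ring R"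
proof -
  have ec: "e \<in> carrier R"
    using e by (simp add: idempotents_def)
  have comm: "f \<otimes> x = x \<otimes> f" if "f \<in> idempotents R" "x \<in> carrier R" for f x
    using that assms(2) unfolding abelian_ring_def by blast
  have compl: "\<one> \<ominus> e \<noteq> \<one>"
    using compl_compl[OF ec] compl_eq_zero_iff[OF one_closed] e by metis
  have unit: "u = \<one>" if u: "u \<in> Units R" for u
  proof -
    have uc: "u \<in> carrier R"
      using u by (rule Units_closed)
    have "u \<otimes> e = e"
      using central_idempotent_mult_unit[OF cover e(1,3) u comm[OF e(1) uc]] .
    moreover have "u \<otimes> (\<one> \<ominus> e) = \<one> \<ominus> e"
      using central_idempotent_mult_unit[OF cover idempotent_compl[OF e(1)] compl u]
        comm[OF idempotent_compl[OF e(1)] uc] by blast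
    moreover have "u \<otimes> e \<oplus> u \<otimes> (\<one> \<ominus> e) = u"
    proof -
      have "u \<otimes> e \<oplus> u \<otimes> (\<one> \<ominus> e) = u \<otimes> \<one>"
        using uc ec by algebra
      then show ?thesis
        using uc by simp
    qed
    moreover have "e \<oplus> (\<one> \<ominus> e) = \<one>"
      using ec by algebra
    ultimately show ?thesis
      by simp
  qed
  have "x \<in> idempotents R" if x: "x \<in> carrier R" for x
  proof -
    consider "x \<in> Units R" | "x \<in> Delta R" | "x \<in> idempotents R"
      using x unfolding cover by blast
    then show ?thesis
    proof cases
      case 1
      then show ?thesis
        using unit[OF 1] by (simp add: idempotents_def)
    next
      case 2
      then have "x \<oplus> \<one> = \<one>"
        by (intro unit Delta_add_unit Units_one_closed)
      then have "x = \<zero>"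
        using x by simp
      then show ?thesis
        by (simp add: idempotents_def)
    qed
  qed
  then show ?thesis
    unfolding boolean_ring_def using ring_axioms by (intro conjI ballI)
qed

section \<open>Two-element rings, the exceptional case\<close>

lemma one_plus_one_two_element:
  assumes "carrier R = {\<zero>, \<one>}" "\<one> \<noteq> \<zero>"
  shows "\<one> \<oplus> \<one> = \<zero>"
proof (rule ccontr)
  assume "\<one> \<oplus> \<one> \<noteq> \<zero>"
  then have "\<one> \<oplus> \<one> = \<one>"
    using assms(1) add.m_closed[OF one_closed one_closed] by blast
  then show False
    using assms(2) by (simp add: add.l_cancel_one)
qed

end

text \<open>The ring axioms fix both operation tables once \<open>1 + 1 = 0\<close> is known, so
  matching \<open>0\<close> with \<open>0\<close> and \<open>1\<close> with \<open>1\<close> is an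
  isomorphism.\<close>

lemma two_element_rings_iso:
  assumes "ring R" "carrier R = {\<zero>\<^bsub>R\<^esub>, \<one>\<^bsub>R\<^esub>}" "\<one>\<^bsub>R\<^esub> \<noteq> \<zero>\<^bsub>R\<^esub>"
    and "ring S" "carrier S = {\<zero>\<^bsub>S\<^esub>, \<one>\<^bsub>S\<^esub>}" "\<one>\<^bsub>S\<^esub> \<noteq> \<zero>\<^bsub>S\<^esub>"
  shows "R \<simeq> S"
proof -
  interpret R: ring R by fact
  interpret S: ring S by fact
  let ?h = "\<lambda>x. if x = \<zero>\<^bsub>R\<^esub> then \<zero>\<^bsub>S\<^esub> else \<one>\<^bsub>S\<^esub>"
  have "?h \<in> ring_iso R S"
  proof (rule ring_iso_memI)
    show "?h x \<in> carrier S" for x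
      by simp
    show "?h (x \<otimes>\<^bsub>R\<^esub> y) = ?h x \<otimes>\<^bsub>S\<^esub> ?h y" if "x \<in> carrier R" "y \<in> carrier R" for x y
      using that assms(2,3) by auto
    show "?h (x \<oplus>\<^bsub>R\<^esub> y) = ?h x \<oplus>\<^bsub>S\<^esub> ?h y" if "x \<in> carrier R" "y \<in> carrier R" for x y
      using that assms(2,3) R.one_plus_one_two_element[OF assms(2,3)]
        S.one_plus_one_two_element[OF assms(5,6)] by auto
    show "bij_betw ?h (carrier R) (carrier S)"
      using assms(3,6) by (auto simp: bij_betw_def inj_on_def assms(2,5))
  qed (use assms(3) in simp)
  then show ?thesis
    by (auto simp: is_ring_iso_def)
qed

lemma ring_iso_two_element:
  assumes "ring R" "ring S" "R \<simeq> S"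
    and "carrier S = {\<zero>\<^bsub>S\<^esub>, \<one>\<^bsub>S\<^esub>}" "\<one>\<^bsub>S\<^esub> \<noteq> \<zero>\<^bsub>S\<^esub>"
  shows "carrier R = {\<zero>\<^bsub>R\<^esub>, \<one>\<^bsub>R\<^esub>} \<and> \<one>\<^bsub>R\<^esub> \<noteq> \<zero>\<^bsub>R\<^esub>"
proof -
  interpret R: ring R by fact
  obtain h where h: "h \<in> ring_iso R S"
    using assms(3) by (auto simp: is_ring_iso_def)
  then have inj: "inj_on h (carrier R)" and zero: "h \<zero>\<^bsub>R\<^esub> = \<zero>\<^bsub>S\<^esub>"
    using ring_hom_zero[OF _ assms(1,2)] by (auto simp: ring_iso_def bij_betw_def)
  have one: "h \<one>\<^bsub>R\<^esub> = \<one>\<^bsub>S\<^esub>"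
    by (rule ring_iso_memE(4)[OF h])
  have "x = \<zero>\<^bsub>R\<^esub> \<or> x = \<one>\<^bsub>R\<^esub>" if "x \<in> carrier R" for x
  proof -
    have "h x = h \<zero>\<^bsub>R\<^esub> \<or> h x = h \<one>\<^bsub>R\<^esub>"
      using ring_iso_memE(1)[OF h that] assms(4) zero one by simp
    then show ?thesis
      using inj_onD[OF inj] that R.zero_closed R.one_closed by blast
  qed
  then have "carrier R = {\<zero>\<^bsub>R\<^esub>, \<one>\<^bsub>R\<^esub>}"
    by blast
  moreover have "\<one>\<^bsub>R\<^esub> \<noteq> \<zero>\<^bsub>R\<^esub>"
    using zero one assms(5) by auto
  ultimately show ?thesis ..
qed

lemma ZFact_two_elements:
  "carrier (ZFact 2) = {\<zero>\<^bsub>ZFact 2\<^esub>, \<one>\<^bsub>ZFact 2\<^esub>}" "\<one>\<^bsub>ZFact 2\<^esub> \<noteq> \<zero>\<^bsub>ZFact 2\<^esub>"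
proof -
  interpret I: ideal "Idl\<^bsub>\<Z>\<^esub> {2}" \<Z>
    by (rule int.genideal_ideal) simp
  have one: "\<one>\<^bsub>ZFact 2\<^esub> = ZMod 2 1"
    by (simp add: ZFact_def FactRing_def ZMod_def)
  have "ZMod 2 0 = Idl\<^bsub>\<Z>\<^esub> {2}"
    using int.a_coset_add_zero[of "Idl\<^bsub>\<Z>\<^esub> {2}"] by (simp add: ZMod_def)
  then have zero: "\<zero>\<^bsub>ZFact 2\<^esub> = ZMod 2 0"
    by (simp add: ZFact_def FactRing_def)
  show "\<one>\<^bsub>ZFact 2\<^esub> \<noteq> \<zero>\<^bsub>ZFact 2\<^esub>"
    \<comment> \<open>Equality of cosets becomes equality of residues modulo
      \<open>2\<close>.\<close>
    unfolding one zero ZMod_eq_mod by simp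
  have "carrier (ZFact 2) = range (ZMod 2)"
    by (auto simp: ZFact_def FactRing_def A_RCOSETS_def' ZMod_def)
  also have "\<dots> = {ZMod 2 0, ZMod 2 1}"
  proof -
    have "ZMod 2 k = ZMod 2 0 \<or> ZMod 2 k = ZMod 2 1" for k
      unfolding ZMod_eq_mod by presburger
    then show ?thesis
      by blast
  qed
  finally show "carrier (ZFact 2) = {\<zero>\<^bsub>ZFact 2\<^esub>, \<one>\<^bsub>ZFact 2\<^esub>}"
    by (simp only: one zero)
qed

text \<open>Turns the isomorphism condition into one on the carrier, which can be compared directly
  with the set of idempotents.\<close>

lemma (in ring) iso_ZFact_two_iff:
  "R \<simeq> ZFact 2 \<longleftrightarrow> carrier R = {\<zero>, \<one>} \<and> \<one> \<noteq> \<zero>"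
  using two_element_rings_iso[OF ring_axioms _ _ _ ZFact_two_elements]
    ring_iso_two_element[OF ring_axioms _ _ ZFact_two_elements]
    cring.axioms(1)[OF ZFact_is_cring] by blast

(* The field with two elements satisfies the hypotheses and is both local and
   Boolean, so "exactly one" holds up to this single exception. *)
theorem theorem2p2:
  fixes R :: "('a, 'b) ring_scheme"
  assumes "ring R"
    and "carrier R = Units R \<union> Delta R \<union> idempotents R"
  shows "(\<not> R \<simeq> ZFact 2 \<longrightarrow>
            exactly_one_of
              (local_ring R)
              (boolean_ring R)
              (\<not> abelian_ring R \<and> dedekind_finite R \<and> ring_characteristic R = 2)) \<and>
         (R \<simeq> ZFact 2 \<longrightarrow>
            local_ring R \<and> boolean_ring R \<and>
            \<not> (\<not> abelian_ring R \<and> dedekind_finite R \<and> ring_characteristic R = 2))"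
proof -
  interpret ring R by fact
  note cover = assms(2)
  have triv_mem: "\<zero>\<^bsub>R\<^esub> \<in> idempotents R" "\<one>\<^bsub>R\<^esub> \<in> idempotents R"
    by (simp_all add: idempotents_def)
  have idem_sub: "idempotents R \<subseteq> carrier R"
    by (auto simp: idempotents_def)
  have triv_abelian: "abelian_ring R" if "idempotents R \<subseteq> {\<zero>\<^bsub>R\<^esub>, \<one>\<^bsub>R\<^esub>}"
    unfolding abelian_ring_def
  proof (intro conjI ballI)
    fix f x assume "f \<in> idempotents R" "x \<in> carrier R"
    then show "f \<otimes>\<^bsub>R\<^esub> x = x \<otimes>\<^bsub>R\<^esub> f"
      using that by auto
  qed fact
  have local_triv: "idempotents R \<subseteq> {\<zero>\<^bsub>R\<^esub>, \<one>\<^bsub>R\<^esub>}" if "local_ring R"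
    using local_ring_idempotents[OF that] by blast
  have boolean_iff: "boolean_ring R \<longleftrightarrow> carrier R = idempotents R"
    using idem_sub assms(1) unfolding boolean_ring_def by blast
  show ?thesis
  proof (cases "\<one>\<^bsub>R\<^esub> = \<zero>\<^bsub>R\<^esub>")
    case True
    \<comment> \<open>The zero ring is Boolean and abelian but not local, so exactly the second
      alternative holds.\<close>
    have "carrier R = {\<zero>\<^bsub>R\<^esub>}"
      using True by (simp add: carrier_one_zero)
    then have "carrier R = idempotents R" "idempotents R \<subseteq> {\<zero>\<^bsub>R\<^esub>, \<one>\<^bsub>R\<^esub>}"
      using triv_mem idem_sub by auto
    then have "boolean_ring R" "abelian_ring R"
      using boolean_iff triv_abelian by simp_all
    moreover have "\<not> local_ring R"
      using True local_ring_one_not_zero by (rule contrapos_pn)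
    moreover have "\<not> R \<simeq> ZFact 2"
      using True by (simp add: iso_ZFact_two_iff)
    ultimately show ?thesis
      by (simp add: exactly_one_of_def)
  next
    case nonzero: False
    show ?thesis
    proof (cases "idempotents R \<subseteq> {\<zero>\<^bsub>R\<^esub>, \<one>\<^bsub>R\<^esub>}")
      case True
      have "local_ring R"
        using cover nonzero True by (rule local_ring_of_trivial_idempotents)
      moreover have "idempotents R = {\<zero>\<^bsub>R\<^esub>, \<one>\<^bsub>R\<^esub>}"
        using True triv_mem by (intro subset_antisym) simp_all
      \<comment> \<open>With \<open>0\<close> and \<open>1\<close> as the only idempotents, Boolean
        means that the carrier is \<open>{0, 1}\<close>; here the exception arises.\<close>
      then have "boolean_ring R \<longleftrightarrow> R \<simeq> ZFact 2"
        using nonzero by (simp add: boolean_iff iso_ZFact_two_iff)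
      ultimately show ?thesis
        using triv_abelian[OF True] by (simp add: exactly_one_of_def)
    next
      case False
      then obtain e where e: "e \<in> idempotents R" "e \<noteq> \<zero>\<^bsub>R\<^esub>" "e \<noteq> \<one>\<^bsub>R\<^esub>"
        by blast
      have "\<not> local_ring R"
        using False local_triv by (rule contrapos_nn)
      moreover have "\<not> R \<simeq> ZFact 2"
      proof
        assume "R \<simeq> ZFact 2"
        then have "carrier R = {\<zero>\<^bsub>R\<^esub>, \<one>\<^bsub>R\<^esub>}"
          unfolding iso_ZFact_two_iff by (rule conjunct1)
        then show False
          using False idem_sub by simp
      qed
      moreover have "dedekind_finite R"
        using cover by (rule dedekind_finite_of_cover)
      moreover have "ring_characteristic R = 2"
        using one_plus_one_eq_zero[OF cover e] nonzero by (rule ring_characteristic_eq_two)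
      \<comment> \<open>Given a nontrivial idempotent, being abelian or not decides between the
        second and the third alternative.\<close>
      moreover have "boolean_ring R \<longleftrightarrow> abelian_ring R"
        using boolean_ring_of_abelian[OF cover _ e] boolean_ring_imp_abelian by (rule iffI[rotated])
      ultimately show ?thesis
        by (simp add: exactly_one_of_def)
    qed
  qed
qed

end
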